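(* Let $f:\{-1,1\}^n\to\{-1,1\}$. Then \[ m(f)\le m(f\circ\mathsf{XOR})\le 4\,\mathrm{disc}(f\circ\mathsf{XOR})\le 4\,m(f). \]
   Context: $(f\circ\mathsf{XOR}):\{-1,1\}^n\times\{-1,1\}^n\to\{-1,1\}$ is $(f\circ\mathsf{XOR})(x,y)=f(x_1y_1,\dots,x_ny_n)$, viewed both as a function of $2n$ variables and as a two-party communication matrix (Alice holds $x$, Bob holds $y$). For $p:\{-1,1\}^N\to\mathbb{R}$ with multilinear expansion $\sum_S c_S\prod_{i\in S}x_i$, $wt(p)=\sum_S|c_S|$. The margin of $g:\{-1,1\}^N\to\{-1,1\}$ is $m(g)=\max_p\min_{x}p(x)g(x)$, the maximum over real polynomials $p$ with $wt(p)\le1$ that sign represent $g$ everywhere. For $F:X\times Y\to\{-1,1\}$ and a distribution $\lambda$ on $X\times Y$, $\mathrm{disc}_\lambda(F)=\max_{S\subseteq X,T\subseteq Y}\big|\sum_{(x,y)\in S\times T}F(x,y)\lambda(x,y)\big|$, and $\mathrm{disc}(F)=\min_\lambda\mathrm{disc}_\lambda(F)$. *)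

theory Defs
  imports "HOL-Probability.Probability_Mass_Function" "HOL-Library.FuncSet"
begin

text \<open>Points of \<open>{-1,1}\<^sup>N\<close> are extensional functions on \<open>{..<N}\<close>; functions on the
  cube are total functions of which only the values on \<open>cube N\<close> matter.\<close>

definition cube :: "nat \<Rightarrow> (nat \<Rightarrow> real) set" where
  "cube N = ({..<N} \<rightarrow>\<^sub>E {-1, 1})"

text \<open>A multilinear polynomial \<open>\<Sum>\<^sub>S c\<^sub>S \<Prod>\<^sub>i\<^sub>\<in>\<^sub>S x\<^sub>i\<close> in \<open>N\<close> variables is given by its coefficient
  family \<open>c\<close>, indexed by the subsets of \<open>{..<N}\<close>; every real function on the cube has
  exactly one such expansion.\<close>

definition mlpoly :: "nat \<Rightarrow> (nat set \<Rightarrow> real) \<Rightarrow> (nat \<Rightarrow> real) \<Rightarrow> real" where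
  "mlpoly N c x = (\<Sum>S\<in>Pow {..<N}. c S * (\<Prod>i\<in>S. x i))"

definition wt :: "nat \<Rightarrow> (nat set \<Rightarrow> real) \<Rightarrow> real" where
  "wt N c = (\<Sum>S\<in>Pow {..<N}. \<bar>c S\<bar>)"

definition sign_represents :: "nat \<Rightarrow> (nat set \<Rightarrow> real) \<Rightarrow> ((nat \<Rightarrow> real) \<Rightarrow> real) \<Rightarrow> bool" where
  "sign_represents N c g \<longleftrightarrow> (\<forall>x\<in>cube N. sgn (mlpoly N c x) = g x)"

text \<open>For \<open>g : {-1,1}\<^sup>N \<rightarrow> {-1,1}\<close> the supremum is of a nonempty set of reals in \<open>{0<..1}\<close>. It is
  attained: a maximiser over the compact set of \<open>c\<close> with \<open>wt N c \<le> 1\<close> (and \<open>c\<close> vanishing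
  outside \<open>Pow {..<N}\<close>) has a positive minimum, hence sign represents \<open>g\<close>.\<close>

definition margin :: "nat \<Rightarrow> ((nat \<Rightarrow> real) \<Rightarrow> real) \<Rightarrow> real" where
  "margin N g = (SUP c \<in> {c. wt N c \<le> 1 \<and> sign_represents N c g}.
                   Min ((\<lambda>x. mlpoly N c x * g x) ` cube N))"

text \<open>Likewise, for finite nonempty \<open>X\<close> and \<open>Y\<close> the infimum in \<open>disc\<close> is a minimum, by
  compactness of the simplex of distributions on \<open>X \<times> Y\<close>.\<close>

definition disc_wrt :: "('a \<times> 'b) pmf \<Rightarrow> 'a set \<Rightarrow> 'b set \<Rightarrow> ('a \<times> 'b \<Rightarrow> real) \<Rightarrow> real" where
  "disc_wrt \<mu> X Y F =
     Max {\<bar>\<Sum>(x, y)\<in>S \<times> T. F (x, y) * pmf \<mu> (x, y)\<bar> | S T. S \<subseteq> X \<and> T \<subseteq> Y}"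

definition disc :: "'a set \<Rightarrow> 'b set \<Rightarrow> ('a \<times> 'b \<Rightarrow> real) \<Rightarrow> real" where
  "disc X Y F = (INF \<mu> \<in> {\<mu>. set_pmf \<mu> \<subseteq> X \<times> Y}. disc_wrt \<mu> X Y F)"

definition comp_XOR ::
    "nat \<Rightarrow> ((nat \<Rightarrow> real) \<Rightarrow> real) \<Rightarrow> (nat \<Rightarrow> real) \<times> (nat \<Rightarrow> real) \<Rightarrow> real" where
  "comp_XOR n f = (\<lambda>(x, y). f (\<lambda>i\<in>{..<n}. x i * y i))"

text \<open>A two-party function on \<open>{-1,1}\<^sup>n \<times> {-1,1}\<^sup>n\<close> as a function of \<open>2n\<close> variables: the first
  \<open>n\<close> coordinates form \<open>x\<close>, the last \<open>n\<close> form \<open>y\<close>.\<close>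

definition as_2n_vars ::
    "nat \<Rightarrow> ((nat \<Rightarrow> real) \<times> (nat \<Rightarrow> real) \<Rightarrow> real) \<Rightarrow> (nat \<Rightarrow> real) \<Rightarrow> real" where
  "as_2n_vars n F z = F (\<lambda>i\<in>{..<n}. z i, \<lambda>i\<in>{..<n}. z (n + i))"

end

theory Submission
  imports Defs
begin

text \<open>
  For the first inequality, substitute \<open>x\<^sub>i y\<^sub>i\<close> into a polynomial for \<open>f\<close>; this keeps its weight.

  For the second, average \<open>p F\<close> over a distribution \<open>\<lambda>\<close>: some character has correlation at least
  the margin with \<open>F\<close> under \<open>\<lambda>\<close>, and a character is a product of a sign in \<open>x\<close> and a sign in \<open>y\<close>,
  so it splits the matrix into four rectangles.

  For the third, minimax duality yields a distribution \<open>\<mu>\<close> under which \<open>f\<close> has correlation at most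
  \<open>m(f) + \<epsilon>\<close> with every character. Put \<open>\<lambda>(x, y) = \<mu>(x y) / 2\<^sup>n\<close>. Characters diagonalise the matrix
  \<open>(f \<mu>)(x y)\<close>, so its correlation with a rectangle is bounded by its largest Fourier coefficient.

  Since \<open>disc\<close> is an infimum, an approximate minimax theorem is enough: \<open>\<mu>\<close> is read off
  from the first-order optimality of a near-minimiser of \<open>\<Sum>\<^sub>x max(0, t - p(x) f(x))\<^sup>2\<close> with
  \<open>t = m(f) + \<epsilon>\<close>, and no compactness or separation argument is needed.
\<close>

section \<open>An approximate minimax theorem\<close>

text \<open>If \<open>u - h\<close> is negative the left side vanishes; otherwise
  \<open>u \<le> max 0 u\<close> suffices. This replaces a derivative: the truncated square after a
  step \<open>h\<close> is bounded by a quadratic in \<open>h\<close>.\<close>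

lemma max0_diff_power2_le:
  fixes u h :: real
  shows "(max 0 (u - h))\<^sup>2 \<le> (max 0 u - h)\<^sup>2"
proof (cases "u - h \<ge> 0")
  case True
  then show ?thesis by (auto intro!: power_mono)
next
  case False
  then show ?thesis by (simp add: max_def)
qed

text \<open>Duality of the l1 and maximum norms. It serves for payoffs, for polynomial values and
  for correlations with characters.\<close>

lemma l1_combination_bound:
  fixes c \<phi> :: "'b \<Rightarrow> real"
  assumes "\<And>i. i \<in> I \<Longrightarrow> \<bar>\<phi> i\<bar> \<le> B" and "0 \<le> B" and "(\<Sum>i\<in>I. \<bar>c i\<bar>) \<le> 1"
  shows "\<bar>\<Sum>i\<in>I. c i * \<phi> i\<bar> \<le> B"
proof -
  have "\<bar>\<Sum>i\<in>I. c i * \<phi> i\<bar> \<le> (\<Sum>i\<in>I. \<bar>c i\<bar> * B)"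
    by (rule order.trans[OF sum_abs])
       (auto simp: abs_mult intro!: sum_mono mult_left_mono assms)
  also have "\<dots> = (\<Sum>i\<in>I. \<bar>c i\<bar>) * B" by (simp add: sum_distrib_right)
  also have "\<dots> \<le> 1 * B" by (intro mult_right_mono assms)
  finally show ?thesis by simp
qed

text \<open>A zero-sum game: one player picks \<open>c\<close> in the l1 ball, the other a point
  \<open>x\<close>. \<open>game_value\<close> says that no \<open>c\<close> secures more than
  \<open>m\<close>; \<open>\<mu>\<close> is a mixed strategy conceding at most
  \<open>m + \<epsilon>\<close>. The l1 ball is spanned by signed unit vectors, hence the absolute
  value in the conclusion.\<close>

lemma approx_minimax_l1:
  fixes \<phi> :: "'b \<Rightarrow> 'a \<Rightarrow> real" and m \<epsilon> :: real
  assumes finX: "finite X" and finI: "finite I"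
    and bound: "\<And>i x. i \<in> I \<Longrightarrow> x \<in> X \<Longrightarrow> \<bar>\<phi> i x\<bar> \<le> 1"
    and game_value: "\<And>c. (\<Sum>i\<in>I. \<bar>c i\<bar>) \<le> 1 \<Longrightarrow> \<exists>x\<in>X. (\<Sum>i\<in>I. c i * \<phi> i x) \<le> m"
    and eps: "\<epsilon> > 0"
  obtains \<mu> where "\<And>x. x \<in> X \<Longrightarrow> 0 \<le> \<mu> x" and "(\<Sum>x\<in>X. \<mu> x) = 1"
    and "\<And>i. i \<in> I \<Longrightarrow> \<bar>\<Sum>x\<in>X. \<mu> x * \<phi> i x\<bar> \<le> m + \<epsilon>"
proof -
  define p where "p c x = (\<Sum>i\<in>I. c i * \<phi> i x)" for c :: "'b \<Rightarrow> real" and x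
  define C where "C = {c :: 'b \<Rightarrow> real. (\<Sum>i\<in>I. \<bar>c i\<bar>) \<le> 1}"
  define t where "t = m + \<epsilon>"
  \<comment> \<open>\<open>W c x\<close> is the shortfall of the payoff below the target
    \<open>t\<close>.\<close>
  define W where "W c x = max 0 (t - p c x)" for c x
  define \<Phi> where "\<Phi> c = (\<Sum>x\<in>X. (W c x)\<^sup>2)" for c
  \<comment> \<open>Payoffs lie in [-1, 1], so squared differences are at most 4 and
    \<open>N\<close> bounds their sum over \<open>X\<close>; the 1 makes \<open>N\<close> positive.
    The step length \<open>s\<close> keeps the second-order error \<open>s\<^sup>2 * N\<close>
    within the slack \<open>s * \<epsilon>\<^sup>2\<close> of the near-minimiser.\<close>
  define N where "N = 4 * real (card X) + 1"
  define s where "s = min 1 (\<epsilon>\<^sup>2 / N)"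
  have N: "N > 0" by (simp add: N_def)
  have s: "0 < s" "s \<le> 1" "s * N \<le> \<epsilon>\<^sup>2"
    using N eps by (auto simp: s_def min_def field_simps)
  have p_abs: "\<bar>p c x\<bar> \<le> 1" if "c \<in> C" "x \<in> X" for c x
    unfolding p_def using that by (intro l1_combination_bound) (auto simp: C_def bound)
  have "(\<lambda>_. 0) \<in> C" by (simp add: C_def)
  moreover have bdd: "bdd_below (\<Phi> ` C)"
    by (rule bdd_belowI2[of _ 0]) (auto simp: \<Phi>_def intro!: sum_nonneg)
  ultimately obtain c where c: "c \<in> C" "\<Phi> c < Inf (\<Phi> ` C) + s * \<epsilon>\<^sup>2"
    using cInf_lessD[of "\<Phi> ` C" "Inf (\<Phi> ` C) + s * \<epsilon>\<^sup>2"] s(1) eps by auto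
  have near_min: "\<Phi> c \<le> \<Phi> d + s * \<epsilon>\<^sup>2" if "d \<in> C" for d
    using c(2) cInf_lower[OF imageI[OF that] bdd] by linarith
  define w where "w = W c"
  have w_nonneg: "w x \<ge> 0" for x by (simp add: w_def W_def)
  \<comment> \<open>The target exceeds \<open>m\<close> by \<open>\<epsilon>\<close>, so the
    shortfall at \<open>x0\<close> is at least \<open>\<epsilon>\<close>. Hence the weights
    \<open>w\<close> can be normalised, and their sum of squares later absorbs the error
    \<open>\<epsilon>\<^sup>2\<close> of \<open>descent\<close>.\<close>
  obtain x0 where x0: "x0 \<in> X" "p c x0 \<le> m"
    using game_value[of c] c(1) by (auto simp: C_def p_def)
  have "\<epsilon> \<le> w x0" using x0 by (simp add: w_def W_def t_def)
  then have w_pos: "w x0 > 0" and "\<epsilon>\<^sup>2 \<le> (w x0)\<^sup>2" using eps by auto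
  then have Phi_ge: "\<epsilon>\<^sup>2 \<le> (\<Sum>x\<in>X. (w x)\<^sup>2)"
    using member_le_sum[of x0 X "\<lambda>x. (w x)\<^sup>2"] x0(1) finX by auto
  have sum_w_pos: "(\<Sum>x\<in>X. w x) > 0"
    using w_pos x0(1) finX w_nonneg by (intro sum_pos2[of X x0]) auto

  \<comment> \<open>First-order optimality of \<open>c\<close>, up to \<open>\<epsilon>\<^sup>2\<close>, in the direction of \<open>d\<close>.\<close>
  have descent: "(\<Sum>x\<in>X. w x * (p d x - p c x)) \<le> \<epsilon>\<^sup>2" if d: "d \<in> C" for d
  proof -
    define k where "k x = p d x - p c x" for x
    \<comment> \<open>A step of length \<open>s\<close> from \<open>c\<close> towards
      \<open>d\<close>; convexity keeps it in \<open>C\<close>.\<close>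
    define e where "e i = (1 - s) * c i + s * d i" for i
    have "(\<Sum>i\<in>I. \<bar>e i\<bar>) \<le> (\<Sum>i\<in>I. (1 - s) * \<bar>c i\<bar> + s * \<bar>d i\<bar>)"
    proof (rule sum_mono)
      fix i
      have "\<bar>e i\<bar> \<le> \<bar>(1 - s) * c i\<bar> + \<bar>s * d i\<bar>" unfolding e_def by (rule abs_triangle_ineq)
      then show "\<bar>e i\<bar> \<le> (1 - s) * \<bar>c i\<bar> + s * \<bar>d i\<bar>" using s by (simp add: abs_mult)
    qed
    also have "\<dots> = (1 - s) * (\<Sum>i\<in>I. \<bar>c i\<bar>) + s * (\<Sum>i\<in>I. \<bar>d i\<bar>)"
      by (simp add: sum.distrib sum_distrib_left)
    also have "\<dots> \<le> (1 - s) * 1 + s * 1"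
      using c(1) d s by (intro add_mono mult_left_mono) (auto simp: C_def)
    finally have e: "e \<in> C" by (simp add: C_def)
    have pe: "p e x = p c x + s * k x" for x
      by (simp add: p_def e_def k_def algebra_simps sum.distrib sum_distrib_left sum_subtractf)
    have "\<Phi> e \<le> (\<Sum>x\<in>X. (w x - s * k x)\<^sup>2)"
      unfolding \<Phi>_def
    proof (rule sum_mono)
      fix x
      show "(W e x)\<^sup>2 \<le> (w x - s * k x)\<^sup>2"
        using max0_diff_power2_le[of "t - p c x" "s * k x"]
        by (simp add: w_def W_def pe algebra_simps)
    qed
    also have "\<dots> = \<Phi> c - 2 * s * (\<Sum>x\<in>X. w x * k x) + s\<^sup>2 * (\<Sum>x\<in>X. (k x)\<^sup>2)"
      by (simp add: \<Phi>_def w_def power2_eq_square algebra_simps sum.distrib sum_subtractf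
          sum_distrib_left)
    finally have "2 * s * (\<Sum>x\<in>X. w x * k x) \<le> s\<^sup>2 * (\<Sum>x\<in>X. (k x)\<^sup>2) + s * \<epsilon>\<^sup>2"
      using near_min[OF e] by linarith
    also have "(\<Sum>x\<in>X. (k x)\<^sup>2) \<le> (\<Sum>x\<in>X. 4)"
    proof (rule sum_mono)
      fix x assume "x \<in> X"
      then have "\<bar>k x\<bar> \<le> 2" using p_abs[OF d] p_abs[OF c(1)] unfolding k_def by fastforce
      then have "\<bar>k x\<bar>\<^sup>2 \<le> 2\<^sup>2" by (intro power_mono) auto
      then show "(k x)\<^sup>2 \<le> 4" by simp
    qed
    also have "\<dots> \<le> N" by (simp add: N_def)
    finally have "2 * s * (\<Sum>x\<in>X. w x * k x) \<le> s\<^sup>2 * N + s * \<epsilon>\<^sup>2"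
      using s by (simp add: mult_left_mono)
    also have "\<dots> = s * (s * N + \<epsilon>\<^sup>2)" by (simp add: power2_eq_square algebra_simps)
    also have "\<dots> \<le> s * (2 * \<epsilon>\<^sup>2)" using s by (intro mult_left_mono) auto
    finally have "(2 * s) * (\<Sum>x\<in>X. w x * k x) \<le> (2 * s) * \<epsilon>\<^sup>2" by simp
    then show ?thesis using s by (simp add: k_def)
  qed
  \<comment> \<open>Where the shortfall is positive, \<open>p c x = t - w x\<close>; elsewhere both
    sides vanish.\<close>
  have "(\<Sum>x\<in>X. w x * p c x) = (\<Sum>x\<in>X. t * w x - (w x)\<^sup>2)"
  proof (rule sum.cong[OF refl])
    fix x
    show "w x * p c x = t * w x - (w x)\<^sup>2"
      by (cases "t - p c x \<ge> 0") (auto simp: w_def W_def power2_eq_square algebra_simps)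
  qed
  then have wc: "(\<Sum>x\<in>X. w x * p c x) = t * (\<Sum>x\<in>X. w x) - (\<Sum>x\<in>X. (w x)\<^sup>2)"
    by (simp add: sum_subtractf sum_distrib_left)
  have key: "(\<Sum>x\<in>X. w x * p d x) \<le> t * (\<Sum>x\<in>X. w x)" if "d \<in> C" for d
    using descent[OF that] wc Phi_ge by (simp add: right_diff_distrib sum_subtractf)
  show thesis
  proof (rule that[of "\<lambda>x. w x / (\<Sum>x\<in>X. w x)"])
    show "0 \<le> w x / sum w X" for x using w_nonneg sum_w_pos by simp
    show "(\<Sum>x\<in>X. w x / sum w X) = 1"
      using sum_w_pos by (simp add: sum_divide_distrib[symmetric])
    fix i assume i: "i \<in> I"
    have signed: "r * (\<Sum>x\<in>X. w x * \<phi> i x) \<le> t * sum w X" if r: "\<bar>r\<bar> = 1" for r :: real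
    proof -
      \<comment> \<open>Signed unit vectors are the test directions; the two signs of
        \<open>r\<close> together bound the absolute value.\<close>
      let ?d = "\<lambda>j. if j = i then r else 0"
      have "(\<Sum>j\<in>I. \<bar>?d j\<bar>) = (\<Sum>j\<in>I. if j = i then 1 else 0)"
        by (rule sum.cong) (auto simp: r)
      then have "?d \<in> C" using i finI by (simp add: C_def)
      moreover have "p ?d x = r * \<phi> i x" for x
        using i finI by (simp add: p_def if_distrib[of "\<lambda>a. a * _"] cong: if_cong)
      ultimately show ?thesis using key[of ?d] by (simp add: sum_distrib_left algebra_simps)
    qed
    have "\<bar>\<Sum>x\<in>X. w x * \<phi> i x\<bar> \<le> t * sum w X"
      using signed[of 1] signed[of "-1"] by (simp add: abs_le_iff)
    moreover have "(\<Sum>x\<in>X. w x / sum w X * \<phi> i x) = (\<Sum>x\<in>X. w x * \<phi> i x) / sum w X"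
      by (simp add: sum_divide_distrib)
    ultimately show "\<bar>\<Sum>x\<in>X. w x / sum w X * \<phi> i x\<bar> \<le> m + \<epsilon>"
      using sum_w_pos by (simp add: t_def abs_divide divide_le_eq)
  qed
qed

section \<open>Characters of the cube\<close>

abbreviation chi :: "nat set \<Rightarrow> (nat \<Rightarrow> real) \<Rightarrow> real" where
  "chi S x \<equiv> \<Prod>i\<in>S. x i"

text \<open>The group operation of the cube; the restriction makes the product extensional
  again.\<close>

definition cube_mult :: "nat \<Rightarrow> (nat \<Rightarrow> real) \<Rightarrow> (nat \<Rightarrow> real) \<Rightarrow> nat \<Rightarrow> real" where
  "cube_mult n x y = (\<lambda>i\<in>{..<n}. x i * y i)"

lemma finite_cube [simp]: "finite (cube n)"
  by (simp add: cube_def finite_PiE)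

lemma card_cube: "card (cube n) = 2 ^ n"
  by (simp add: cube_def card_PiE numeral_2_eq_2)

lemma cube_nonempty [simp]: "cube n \<noteq> {}"
  by (simp add: cube_def PiE_eq_empty_iff)

lemma cube_coord: "x \<in> cube n \<Longrightarrow> i < n \<Longrightarrow> x i = -1 \<or> x i = 1"
  by (auto simp: cube_def)

lemma restrict_in_cube: "(\<And>i. i < n \<Longrightarrow> x i = -1 \<or> x i = 1) \<Longrightarrow> (\<lambda>i\<in>{..<n}. x i) \<in> cube n"
  by (auto simp: cube_def)

lemma cube_mult_in_cube:
  assumes "x \<in> cube n" "y \<in> cube n"
  shows "cube_mult n x y \<in> cube n"
  unfolding cube_mult_def
proof (rule restrict_in_cube)
  fix i assume "i < n"
  then show "x i * y i = -1 \<or> x i * y i = 1"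
    using cube_coord[OF assms(1), of i] cube_coord[OF assms(2), of i] by auto
qed

lemma chi_cube_mult: "S \<subseteq> {..<n} \<Longrightarrow> chi S (cube_mult n x y) = chi S x * chi S y"
  by (subst prod.distrib[symmetric], rule prod.cong) (auto simp: cube_mult_def)

lemma prod_sign:
  fixes x :: "'a \<Rightarrow> real"
  assumes "\<And>i. i \<in> S \<Longrightarrow> x i = -1 \<or> x i = 1"
  shows "prod x S = -1 \<or> prod x S = 1"
  using assms
proof (induction S rule: infinite_finite_induct)
  case (insert i S)
  then have "x i = -1 \<or> x i = 1" "prod x S = -1 \<or> prod x S = 1" by blast+
  with insert.hyps show ?case by auto
qed auto

lemma chi_sign: "x \<in> cube n \<Longrightarrow> S \<subseteq> {..<n} \<Longrightarrow> chi S x = -1 \<or> chi S x = 1"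
  by (rule prod_sign, rule cube_coord) auto

lemma abs_chi: "x \<in> cube n \<Longrightarrow> S \<subseteq> {..<n} \<Longrightarrow> \<bar>chi S x\<bar> = 1"
  using chi_sign[of x n S] by auto

lemma cube_mult_involution:
  assumes "x \<in> cube n" "y \<in> cube n"
  shows "cube_mult n x (cube_mult n x y) = y"
proof
  fix i
  show "cube_mult n x (cube_mult n x y) i = y i"
  proof (cases "i < n")
    case True
    then show ?thesis using cube_coord[OF assms(1) True] by (auto simp: cube_mult_def)
  next
    \<comment> \<open>Outside \<open>{..<n}\<close> both sides are \<open>undefined\<close>, since
      \<open>y\<close> is extensional.\<close>
    case False
    then show ?thesis
      using PiE_arb[OF assms(2)[unfolded cube_def], of i] by (simp add: cube_mult_def)
  qed
qed

text \<open>Translation by \<open>x\<close> is its own inverse, hence a bijection of the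
  cube.\<close>

lemma sum_cube_mult:
  assumes "x \<in> cube n"
  shows "(\<Sum>y\<in>cube n. h (cube_mult n x y)) = (\<Sum>z\<in>cube n. h z)"
  by (rule sum.reindex_bij_witness[of _ "cube_mult n x" "cube_mult n x"])
     (auto simp: assms cube_mult_involution cube_mult_in_cube)

text \<open>The sum over all \<open>S\<close> factors as the product of the
  \<open>x i * y i + 1\<close>. A coordinate where the points differ gives a factor 0; where they
  agree the factor is 2.\<close>

lemma chi_orthogonal:
  assumes "x \<in> cube n" "y \<in> cube n"
  shows "(\<Sum>S\<in>Pow {..<n}. chi S x * chi S y) = (if x = y then 2 ^ n else 0)"
proof -
  have "(\<Sum>S\<in>Pow {..<n}. chi S x * chi S y) = (\<Prod>i<n. x i * y i + 1)"
    by (simp add: prod_add prod.distrib)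
  also have "\<dots> = (if x = y then 2 ^ n else 0)"
  proof (cases "x = y")
    case True
    have "(\<Prod>i<n. x i * x i + 1) = (\<Prod>i<n. 2)"
      using cube_coord[OF assms(1)] by (intro prod.cong) fastforce+
    then show ?thesis using True by simp
  next
    case False
    then obtain i where i: "i < n" "x i \<noteq> y i"
      using PiE_ext[of x "{..<n}" "\<lambda>_. {-1, 1}" y] assms by (auto simp: cube_def)
    then have "x i * y i + 1 = 0"
      using cube_coord[OF assms(1), of i] cube_coord[OF assms(2), of i] by auto
    then show ?thesis using False i by (auto intro!: prod_zero)
  qed
  finally show ?thesis .
qed

text \<open>Fourier inversion with unnormalised coefficients, hence the factor \<open>2 ^ n\<close>.
  After swapping the sums, orthogonality leaves only \<open>y = x\<close>.\<close>

lemma chi_inversion: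
  assumes "x \<in> cube n"
  shows "(\<Sum>S\<in>Pow {..<n}. (\<Sum>y\<in>cube n. g y * chi S y) * chi S x) = 2 ^ n * g x"
proof -
  have "(\<Sum>S\<in>Pow {..<n}. (\<Sum>y\<in>cube n. g y * chi S y) * chi S x)
      = (\<Sum>y\<in>cube n. \<Sum>S\<in>Pow {..<n}. g y * chi S y * chi S x)"
    unfolding sum_distrib_right by (rule sum.swap)
  also have "\<dots> = (\<Sum>y\<in>cube n. g y * (\<Sum>S\<in>Pow {..<n}. chi S y * chi S x))"
    by (simp add: sum_distrib_left mult.assoc)
  also have "\<dots> = (\<Sum>y\<in>cube n. if y = x then 2 ^ n * g x else 0)"
    by (rule sum.cong) (auto simp: chi_orthogonal assms)
  also have "\<dots> = 2 ^ n * g x" using assms by simp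
  finally show ?thesis .
qed

text \<open>Parseval for the indicator of \<open>A\<close>: in the expanded squares only the
  diagonal survives.\<close>

lemma chi_parseval_indicator:
  assumes "A \<subseteq> cube n"
  shows "(\<Sum>S\<in>Pow {..<n}. (\<Sum>x\<in>A. chi S x)\<^sup>2) = 2 ^ n * real (card A)"
proof -
  have fin: "finite A" using assms finite_cube finite_subset by blast
  have "(\<Sum>S\<in>Pow {..<n}. (\<Sum>x\<in>A. chi S x)\<^sup>2)
      = (\<Sum>S\<in>Pow {..<n}. \<Sum>x\<in>A. \<Sum>y\<in>A. chi S x * chi S y)"
    by (simp add: power2_eq_square sum_product)
  also have "\<dots> = (\<Sum>x\<in>A. \<Sum>S\<in>Pow {..<n}. \<Sum>y\<in>A. chi S x * chi S y)" by (rule sum.swap)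
  also have "\<dots> = (\<Sum>x\<in>A. \<Sum>y\<in>A. \<Sum>S\<in>Pow {..<n}. chi S x * chi S y)"
    by (intro sum.cong refl sum.swap)
  also have "\<dots> = (\<Sum>x\<in>A. \<Sum>y\<in>A. if x = y then 2 ^ n else 0)"
    using assms by (intro sum.cong refl chi_orthogonal) auto
  also have "\<dots> = 2 ^ n * real (card A)" using fin by simp
  finally show ?thesis .
qed

text \<open>The characters are eigenvectors of the matrix \<open>g (cube_mult n x y)\<close>, with
  the Fourier coefficients of \<open>g\<close> as eigenvalues. So its spectral norm is at most
  \<open>K\<close>, while the indicators of \<open>A\<close> and \<open>B\<close> have squared norm
  at most \<open>2 ^ n\<close>.\<close>

lemma convolution_rectangle_bound:
  assumes A: "A \<subseteq> cube n" and B: "B \<subseteq> cube n"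
    and coeff: "\<And>S. S \<subseteq> {..<n} \<Longrightarrow> \<bar>\<Sum>z\<in>cube n. g z * chi S z\<bar> \<le> K"
  shows "\<bar>\<Sum>x\<in>A. \<Sum>y\<in>B. g (cube_mult n x y)\<bar> \<le> 2 ^ n * K"
proof -
  let ?G = "\<lambda>S. \<Sum>z\<in>cube n. g z * chi S z"
  let ?a = "\<lambda>S. \<Sum>x\<in>A. chi S x" and ?b = "\<lambda>S. \<Sum>y\<in>B. chi S y"
  have K: "K \<ge> 0" using coeff[of "{}"] by force
  have "2 ^ n * (\<Sum>x\<in>A. \<Sum>y\<in>B. g (cube_mult n x y))
      = (\<Sum>x\<in>A. \<Sum>y\<in>B. \<Sum>S\<in>Pow {..<n}. ?G S * (chi S x * chi S y))"
    unfolding sum_distrib_left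
  proof (intro sum.cong refl)
    fix x y assume "x \<in> A" "y \<in> B"
    then have "cube_mult n x y \<in> cube n" using A B by (auto intro: cube_mult_in_cube)
    from chi_inversion[OF this, of g]
    have "2 ^ n * g (cube_mult n x y) = (\<Sum>S\<in>Pow {..<n}. ?G S * chi S (cube_mult n x y))" ..
    also have "\<dots> = (\<Sum>S\<in>Pow {..<n}. ?G S * (chi S x * chi S y))"
      by (rule sum.cong) (auto simp: chi_cube_mult)
    finally show "2 ^ n * g (cube_mult n x y) = \<dots>" .
  qed
  also have "\<dots> = (\<Sum>x\<in>A. \<Sum>S\<in>Pow {..<n}. \<Sum>y\<in>B. ?G S * (chi S x * chi S y))"
    by (intro sum.cong refl sum.swap)
  also have "\<dots> = (\<Sum>S\<in>Pow {..<n}. \<Sum>x\<in>A. \<Sum>y\<in>B. ?G S * (chi S x * chi S y))"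
    by (rule sum.swap)
  also have "\<dots> = (\<Sum>S\<in>Pow {..<n}. ?G S * (?a S * ?b S))"
    proof (rule sum.cong[OF refl])
    fix S
    have "?a S * ?b S = (\<Sum>x\<in>A. \<Sum>y\<in>B. chi S x * chi S y)" by (rule sum_product)
    then show "(\<Sum>x\<in>A. \<Sum>y\<in>B. ?G S * (chi S x * chi S y)) = ?G S * (?a S * ?b S)"
      by (simp only: sum_distrib_left[of "?G S"])
  qed
  finally have expand: "2 ^ n * (\<Sum>x\<in>A. \<Sum>y\<in>B. g (cube_mult n x y))
      = (\<Sum>S\<in>Pow {..<n}. ?G S * (?a S * ?b S))" .
  have parseval: "(\<Sum>S\<in>Pow {..<n}. (\<Sum>x\<in>D. chi S x)\<^sup>2) \<le> 2 ^ n * 2 ^ n" if "D \<subseteq> cube n" for D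
  proof -
    have "card D \<le> 2 ^ n" using card_mono[OF finite_cube that] by (simp add: card_cube)
    then have "real (card D) \<le> 2 ^ n" using of_nat_mono by fastforce
    then show ?thesis unfolding chi_parseval_indicator[OF that] by simp
  qed
  have "\<bar>\<Sum>S\<in>Pow {..<n}. ?G S * (?a S * ?b S)\<bar>
      \<le> (\<Sum>S\<in>Pow {..<n}. K * (((?a S)\<^sup>2 + (?b S)\<^sup>2) / 2))"
  proof (rule order.trans[OF sum_abs sum_mono])
    fix S assume S: "S \<in> Pow {..<n}"
    \<comment> \<open>The arithmetic-geometric mean inequality stands in for Cauchy-Schwarz; it
      loses nothing, as both Parseval sums have the same bound.\<close>
    have "2 * (\<bar>?a S\<bar> * \<bar>?b S\<bar>) \<le> \<bar>?a S\<bar>\<^sup>2 + \<bar>?b S\<bar>\<^sup>2"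
      using sum_squares_bound[of "\<bar>?a S\<bar>" "\<bar>?b S\<bar>"] by (simp add: mult.assoc)
    then have "\<bar>?a S * ?b S\<bar> \<le> ((?a S)\<^sup>2 + (?b S)\<^sup>2) / 2" by (simp add: abs_mult)
    then show "\<bar>?G S * (?a S * ?b S)\<bar> \<le> K * (((?a S)\<^sup>2 + (?b S)\<^sup>2) / 2)"
      unfolding abs_mult[of "?G S"] using coeff[of S] S K by (intro mult_mono) auto
  qed
  also have "\<dots> = K * (((\<Sum>S\<in>Pow {..<n}. (?a S)\<^sup>2) + (\<Sum>S\<in>Pow {..<n}. (?b S)\<^sup>2)) / 2)"
    by (simp only: sum.distrib sum_distrib_left[symmetric] sum_divide_distrib[symmetric])
  also have "\<dots> \<le> K * (2 ^ n * 2 ^ n)"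
    using parseval[OF A] parseval[OF B] K by (intro mult_left_mono) auto
  finally have "\<bar>2 ^ n * (\<Sum>x\<in>A. \<Sum>y\<in>B. g (cube_mult n x y))\<bar> \<le> 2 ^ n * (2 ^ n * K)"
    unfolding expand by (simp add: mult_ac)
  then show ?thesis by (simp add: abs_mult)
qed

section \<open>The margin\<close>

definition representing :: "nat \<Rightarrow> ((nat \<Rightarrow> real) \<Rightarrow> real) \<Rightarrow> (nat set \<Rightarrow> real) set" where
  "representing N g = {c. wt N c \<le> 1 \<and> sign_represents N c g}"

abbreviation min_margin :: "nat \<Rightarrow> ((nat \<Rightarrow> real) \<Rightarrow> real) \<Rightarrow> (nat set \<Rightarrow> real) \<Rightarrow> real" where
  "min_margin N g c \<equiv> Min ((\<lambda>x. mlpoly N c x * g x) ` cube N)"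

lemma margin_eq: "margin N g = (SUP c \<in> representing N g. min_margin N g c)"
  by (simp add: margin_def representing_def)

lemma min_margin_le: "x \<in> cube N \<Longrightarrow> min_margin N g c \<le> mlpoly N c x * g x"
  by (intro Min_le) auto

lemma representing_nonempty:
  assumes "g \<in> cube N \<rightarrow> {-1, 1}"
  shows "representing N g \<noteq> {}"
proof -
  \<comment> \<open>The Fourier coefficients of \<open>g / 2\<^sup>N\<close>: each is at most \<open>2\<^sup>-\<^sup>N\<close> in absolute value.\<close>
  define c where "c S = (\<Sum>y\<in>cube N. g y * chi S y) / 4 ^ N" for S
  have four: "(4::real) ^ N = 2 ^ N * 2 ^ N" by (simp add: power_mult_distrib[symmetric])
  have c: "\<bar>c S\<bar> \<le> 1 / 2 ^ N" if "S \<subseteq> {..<N}" for S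
  proof -
    have "\<bar>\<Sum>y\<in>cube N. g y * chi S y\<bar> \<le> (\<Sum>y\<in>cube N. 1)"
    proof (rule order.trans[OF sum_abs sum_mono])
      fix y assume y: "y \<in> cube N"
      then have "g y \<in> {-1, 1}" using assms by blast
      then show "\<bar>g y * chi S y\<bar> \<le> 1"
        unfolding abs_mult abs_chi[OF y that] by auto
    qed
    then show ?thesis by (simp add: c_def four card_cube field_simps)
  qed
  have "wt N c \<le> (\<Sum>S\<in>Pow {..<N}. 1 / 2 ^ N)"
    unfolding wt_def using c by (intro sum_mono) auto
  then have "wt N c \<le> 1" by (simp add: card_Pow)
  moreover have "mlpoly N c x = g x / 2 ^ N" if "x \<in> cube N" for x
    using chi_inversion[OF that, of g]
    by (simp add: mlpoly_def c_def sum_divide_distrib[symmetric] four)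
  then have "sign_represents N c g"
    using assms by (auto simp: sign_represents_def sgn_divide Pi_iff)
  ultimately show ?thesis by (auto simp: representing_def)
qed

lemma abs_mlpoly_le:
  assumes "x \<in> cube N" "wt N c \<le> 1"
  shows "\<bar>mlpoly N c x\<bar> \<le> 1"
  unfolding mlpoly_def using assms
  by (intro l1_combination_bound) (auto simp: wt_def abs_chi)

text \<open>With \<open>representing_nonempty\<close> this makes the supremum in
  \<open>margin\<close> a genuine one. Any single point of the cube gives the bound 1.\<close>

lemma bdd_above_min_margin:
  assumes "g \<in> cube N \<rightarrow> {-1, 1}"
  shows "bdd_above (min_margin N g ` representing N g)"
proof (rule bdd_aboveI2[where M = 1])
  fix c assume c: "c \<in> representing N g"
  obtain x where x: "x \<in> cube N" using cube_nonempty by blast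
  have "mlpoly N c x * g x \<le> \<bar>mlpoly N c x\<bar>"
    using assms x by (auto simp: Pi_iff abs_if)
  then show "min_margin N g c \<le> 1"
    using min_margin_le[OF x, of c g] abs_mlpoly_le[OF x] c by (force simp: representing_def)
qed

lemma min_margin_pos:
  assumes "g \<in> cube N \<rightarrow> {-1, 1}" "c \<in> representing N g"
  shows "min_margin N g c > 0"
proof -
  have "mlpoly N c x * g x > 0" if "x \<in> cube N" for x
  proof -
    have "g x \<in> {-1, 1}" using assms(1) that by blast
    then have "sgn (mlpoly N c x) = g x" "g x \<noteq> 0"
      using assms(2) that by (auto simp: representing_def sign_represents_def)
    then show ?thesis by (metis abs_sgn zero_less_abs_iff sgn_zero_iff)
  qed
  then show ?thesis by simp
qed

lemma margin_nonneg:
  assumes "g \<in> cube N \<rightarrow> {-1, 1}"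
  shows "margin N g \<ge> 0"
proof -
  obtain c where c: "c \<in> representing N g" using representing_nonempty[OF assms] by blast
  have "0 < min_margin N g c" using assms c by (rule min_margin_pos)
  also have "\<dots> \<le> margin N g"
    unfolding margin_eq using c bdd_above_min_margin[OF assms] by (rule cSUP_upper)
  finally show ?thesis by simp
qed

text \<open>\<open>margin\<close> ranges only over sign-representing polynomials, but the bound
  extends to all of weight at most 1: were all products above the nonnegative margin,
  \<open>c\<close> would sign represent \<open>g\<close> and beat the supremum. This is the
  \<open>game_value\<close> hypothesis of the minimax lemma.\<close>

lemma margin_witness:
  assumes "g \<in> cube N \<rightarrow> {-1, 1}" "wt N c \<le> 1"
  shows "\<exists>x\<in>cube N. mlpoly N c x * g x \<le> margin N g"
proof (rule ccontr)
  assume "\<not> ?thesis"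
  then have gt: "mlpoly N c x * g x > margin N g" if "x \<in> cube N" for x using that by force
  have "sgn (mlpoly N c x) = g x" if "x \<in> cube N" for x
  proof -
    have "mlpoly N c x * g x > 0" using gt[OF that] margin_nonneg[OF assms(1)] by linarith
    moreover have "g x = -1 \<or> g x = 1" using assms(1) that by auto
    ultimately show ?thesis by auto
  qed
  then have "c \<in> representing N g" using assms(2) by (simp add: representing_def sign_represents_def)
  then have "min_margin N g c \<le> margin N g"
    unfolding margin_eq by (intro cSUP_upper bdd_above_min_margin assms)
  moreover have "min_margin N g c > margin N g" using gt by simp
  ultimately show False by simp
qed

section \<open>The two-party function\<close>

lemma comp_XOR_eq: "comp_XOR n f (x, y) = f (cube_mult n x y)"
  by (simp add: comp_XOR_def cube_mult_def)

lemma comp_XOR_in: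
  assumes "f \<in> cube n \<rightarrow> {-1, 1}" "x \<in> cube n" "y \<in> cube n"
  shows "comp_XOR n f (x, y) \<in> {-1, 1}"
  unfolding comp_XOR_eq by (rule funcset_mem[OF assms(1) cube_mult_in_cube[OF assms(2,3)]])

lemma halves_in_cube:
  assumes "z \<in> cube (2 * n)"
  shows "(\<lambda>i\<in>{..<n}. z i) \<in> cube n" "(\<lambda>i\<in>{..<n}. z (n + i)) \<in> cube n"
proof -
  show "(\<lambda>i\<in>{..<n}. z i) \<in> cube n"
    using cube_coord[OF assms] by (intro restrict_in_cube) simp
  show "(\<lambda>i\<in>{..<n}. z (n + i)) \<in> cube n"
    using cube_coord[OF assms, of "n + i" for i] by (intro restrict_in_cube) simp
qed

lemma as_2n_vars_in:
  assumes "\<And>x y. x \<in> cube n \<Longrightarrow> y \<in> cube n \<Longrightarrow> F (x, y) \<in> {-1, 1}"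
  shows "as_2n_vars n F \<in> cube (2 * n) \<rightarrow> {-1, 1}"
proof
  fix z assume "z \<in> cube (2 * n)"
  from assms[OF halves_in_cube[OF this]] show "as_2n_vars n F z \<in> {-1, 1}"
    unfolding as_2n_vars_def .
qed

text \<open>Recombines the two halves that \<open>as_2n_vars\<close> separates, so that a polynomial
  in \<open>2 * n\<close> variables can be evaluated at a pair.\<close>

definition cube_join :: "nat \<Rightarrow> (nat \<Rightarrow> real) \<Rightarrow> (nat \<Rightarrow> real) \<Rightarrow> nat \<Rightarrow> real" where
  "cube_join n x y = (\<lambda>i\<in>{..<2 * n}. if i < n then x i else y (i - n))"

lemma cube_join_in_cube:
  assumes "x \<in> cube n" "y \<in> cube n"
  shows "cube_join n x y \<in> cube (2 * n)"
proof -
  have "(if i < n then x i else y (i - n)) = -1 \<or> (if i < n then x i else y (i - n)) = 1"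
    if "i < 2 * n" for i
    using cube_coord[OF assms(1), of i] cube_coord[OF assms(2), of "i - n"] that by auto
  then show ?thesis unfolding cube_join_def by (rule restrict_in_cube)
qed

lemma as_2n_vars_cube_join:
  assumes "x \<in> cube n" "y \<in> cube n"
  shows "as_2n_vars n F (cube_join n x y) = F (x, y)"
proof -
  have "(\<lambda>i\<in>{..<n}. cube_join n x y i) = x" "(\<lambda>i\<in>{..<n}. cube_join n x y (n + i)) = y"
    using PiE_arb[OF assms(1)[unfolded cube_def]] PiE_arb[OF assms(2)[unfolded cube_def]]
    by (simp_all add: cube_join_def fun_eq_iff)
  then show ?thesis by (simp add: as_2n_vars_def)
qed

text \<open>Splitting \<open>S\<close> at \<open>n\<close> and shifting its upper part down
  separates the variables. This product form is what links polynomials to rectangles.\<close>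

lemma chi_cube_join:
  assumes "S \<subseteq> {..<2 * n}"
  shows "chi S (cube_join n x y) = chi (S \<inter> {..<n}) x * chi {i. n + i \<in> S} y"
proof -
  have fin: "finite S" using assms finite_subset by blast
  have "chi S (cube_join n x y)
      = chi (S \<inter> {..<n}) (cube_join n x y) * chi (S - {..<n}) (cube_join n x y)"
    using fin by (subst prod.Int_Diff[of S _ "{..<n}"]) auto
  also have "chi (S \<inter> {..<n}) (cube_join n x y) = chi (S \<inter> {..<n}) x"
    using assms by (intro prod.cong) (auto simp: cube_join_def)
  also have "chi (S - {..<n}) (cube_join n x y) = chi {i. n + i \<in> S} y"
    using assms by (intro prod.reindex_bij_witness[of _ "\<lambda>i. n + i" "\<lambda>i. i - n"])
      (auto simp: cube_join_def)
  finally show ?thesis .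
qed

section \<open>Margin of the lifted function\<close>

text \<open>Index of the monomial that arises from the monomial of \<open>S\<close> by substituting
  \<open>x i * y i\<close> for each variable.\<close>

definition double_set :: "nat \<Rightarrow> nat set \<Rightarrow> nat set" where
  "double_set n S = S \<union> (\<lambda>i. n + i) ` S"

lemma double_set_Int: "S \<subseteq> {..<n} \<Longrightarrow> double_set n S \<inter> {..<n} = S"
  by (auto simp: double_set_def)

lemma double_set_subset: "S \<subseteq> {..<n} \<Longrightarrow> double_set n S \<subseteq> {..<2 * n}"
  by (auto simp: double_set_def)

lemma inj_on_double_set: "inj_on (double_set n) (Pow {..<n})"
  by (rule inj_on_inverseI[of _ "\<lambda>T. T \<inter> {..<n}"]) (simp add: double_set_Int)

text \<open>Coefficients of the substituted polynomial; intersecting with \<open>{..<n}\<close>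
  inverts \<open>double_set\<close>.\<close>

definition double_coeff :: "nat \<Rightarrow> (nat set \<Rightarrow> real) \<Rightarrow> nat set \<Rightarrow> real" where
  "double_coeff n c T = (if T \<in> double_set n ` Pow {..<n} then c (T \<inter> {..<n}) else 0)"

text \<open>A general \<open>h\<close> lets one reindexing serve both the weight and the evaluation;
  \<open>h 0 T = 0\<close> discards the sets that are not doubled.\<close>

lemma sum_double_coeff:
  fixes h :: "real \<Rightarrow> nat set \<Rightarrow> real"
  assumes "\<And>T. h 0 T = 0"
  shows "(\<Sum>T\<in>Pow {..<2 * n}. h (double_coeff n c T) T) = (\<Sum>S\<in>Pow {..<n}. h (c S) (double_set n S))"
proof -
  have "(\<Sum>T\<in>Pow {..<2 * n}. h (double_coeff n c T) T)
      = (\<Sum>T\<in>double_set n ` Pow {..<n}. h (double_coeff n c T) T)"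
    using double_set_subset
    by (intro sum.mono_neutral_right) (auto simp: double_coeff_def assms)
  also have "\<dots> = (\<Sum>S\<in>Pow {..<n}. h (double_coeff n c (double_set n S)) (double_set n S))"
    by (simp add: sum.reindex[OF inj_on_double_set])
  also have "\<dots> = (\<Sum>S\<in>Pow {..<n}. h (c S) (double_set n S))"
    by (rule sum.cong) (auto simp: double_coeff_def double_set_Int)
  finally show ?thesis .
qed

lemma wt_double_coeff: "wt (2 * n) (double_coeff n c) = wt n c"
  unfolding wt_def using sum_double_coeff[of "\<lambda>a T. \<bar>a\<bar>"] by simp

lemma chi_double_set:
  assumes "S \<subseteq> {..<n}"
  shows "chi (double_set n S) z
    = chi S (cube_mult n (\<lambda>i\<in>{..<n}. z i) (\<lambda>i\<in>{..<n}. z (n + i)))"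
proof -
  have "finite S" using assms finite_subset by blast
  then have "chi (double_set n S) z = chi S z * chi ((\<lambda>i. n + i) ` S) z"
    unfolding double_set_def using assms by (intro prod.union_disjoint) auto
  also have "\<dots> = (\<Prod>i\<in>S. z i * z (n + i))" by (simp add: prod.reindex prod.distrib)
  also have "\<dots> = chi S (cube_mult n (\<lambda>i\<in>{..<n}. z i) (\<lambda>i\<in>{..<n}. z (n + i)))"
    using assms by (intro prod.cong) (auto simp: cube_mult_def)
  finally show ?thesis .
qed

lemma mlpoly_double_coeff:
  "mlpoly (2 * n) (double_coeff n c) z
    = mlpoly n c (cube_mult n (\<lambda>i\<in>{..<n}. z i) (\<lambda>i\<in>{..<n}. z (n + i)))"
  unfolding mlpoly_def using sum_double_coeff[of "\<lambda>a T. a * chi T z"]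
  by (simp add: chi_double_set)

lemma margin_le_margin_XOR:
  assumes f: "f \<in> cube n \<rightarrow> {-1, 1}"
  shows "margin n f \<le> margin (2 * n) (as_2n_vars n (comp_XOR n f))"
proof -
  let ?g = "as_2n_vars n (comp_XOR n f)"
  let ?xy = "\<lambda>z. cube_mult n (\<lambda>i\<in>{..<n}. z i) (\<lambda>i\<in>{..<n}. z (n + i))"
  have g: "?g \<in> cube (2 * n) \<rightarrow> {-1, 1}" by (intro as_2n_vars_in comp_XOR_in f)
  have g_eq: "?g z = f (?xy z)" for z by (simp add: as_2n_vars_def comp_XOR_eq)
  have xy: "?xy z \<in> cube n" if "z \<in> cube (2 * n)" for z
    using cube_mult_in_cube[OF halves_in_cube[OF that]] .
  show ?thesis unfolding margin_eq
  proof (rule cSUP_mono)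
    show "representing n f \<noteq> {}" using f by (rule representing_nonempty)
    show "bdd_above (min_margin (2 * n) ?g ` representing (2 * n) ?g)"
      using g by (rule bdd_above_min_margin)
    fix c assume c: "c \<in> representing n f"
    show "\<exists>d\<in>representing (2 * n) ?g. min_margin n f c \<le> min_margin (2 * n) ?g d"
    proof
      show "double_coeff n c \<in> representing (2 * n) ?g"
        using c xy by (auto simp: representing_def sign_represents_def wt_double_coeff
            mlpoly_double_coeff g_eq)
      \<comment> \<open>Every product for the lifted pair already occurs for \<open>c\<close> and
        \<open>f\<close>, and a minimum over fewer values is no smaller.\<close>
      have "(\<lambda>z. mlpoly (2 * n) (double_coeff n c) z * ?g z) ` cube (2 * n)
          \<subseteq> (\<lambda>x. mlpoly n c x * f x) ` cube n"
        using xy by (auto simp: mlpoly_double_coeff g_eq)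
      then show "min_margin n f c \<le> min_margin (2 * n) ?g (double_coeff n c)"
        by (intro Min_antimono) auto
    qed
  qed
qed

section \<open>Discrepancy bounds\<close>

lemma finite_rectangle_sums:
  assumes "finite X" "finite Y"
  shows "finite {h S T | S T. S \<subseteq> X \<and> T \<subseteq> Y}"
proof -
  have "{h S T | S T. S \<subseteq> X \<and> T \<subseteq> Y} = (\<lambda>(S, T). h S T) ` (Pow X \<times> Pow Y)" by auto
  then show ?thesis using assms by simp
qed

lemma rectangle_le_disc_wrt:
  assumes "finite X" "finite Y" "S \<subseteq> X" "T \<subseteq> Y"
  shows "\<bar>\<Sum>(x, y)\<in>S \<times> T. F (x, y) * pmf \<mu> (x, y)\<bar> \<le> disc_wrt \<mu> X Y F"
  unfolding disc_wrt_def
  by (intro Max_ge finite_rectangle_sums) (use assms in blast)+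

lemma disc_wrt_le:
  assumes "finite X" "finite Y"
    and "\<And>S T. S \<subseteq> X \<Longrightarrow> T \<subseteq> Y \<Longrightarrow> \<bar>\<Sum>(x, y)\<in>S \<times> T. F (x, y) * pmf \<mu> (x, y)\<bar> \<le> K"
  shows "disc_wrt \<mu> X Y F \<le> K"
  unfolding disc_wrt_def
  by (intro Max.boundedI finite_rectangle_sums) (use assms in blast)+

lemma disc_wrt_nonneg:
  assumes "finite X" "finite Y"
  shows "disc_wrt \<mu> X Y F \<ge> 0"
  using rectangle_le_disc_wrt[OF assms, of "{}" "{}" F \<mu>] by simp

section \<open>Margin against discrepancy for two-party functions\<close>

lemma sum_sign_split:
  fixes h a :: "'a \<Rightarrow> real"
  assumes "finite X" "\<And>x. x \<in> X \<Longrightarrow> a x = -1 \<or> a x = 1"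
  shows "(\<Sum>x\<in>X. h x * a x) = (\<Sum>x\<in>{x\<in>X. a x = 1}. h x) - (\<Sum>x\<in>{x\<in>X. a x = -1}. h x)"
proof -
  have "X = {x\<in>X. a x = 1} \<union> {x\<in>X. a x = -1}" using assms(2) by auto
  then have "(\<Sum>x\<in>X. h x * a x)
      = (\<Sum>x\<in>{x\<in>X. a x = 1}. h x * a x) + (\<Sum>x\<in>{x\<in>X. a x = -1}. h x * a x)"
    using assms(1) by (subst sum.union_disjoint[symmetric]) auto
  then show ?thesis by (simp add: sum_negf)
qed

text \<open>The level sets of \<open>a\<close> and \<open>b\<close> cut the matrix into four
  rectangles on which the sign is constant; each contributes at most the discrepancy.\<close>

lemma sign_product_le_4_disc_wrt:
  fixes a :: "'a \<Rightarrow> real" and b :: "'b \<Rightarrow> real"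
  assumes fin: "finite X" "finite Y"
    and a: "\<And>x. x \<in> X \<Longrightarrow> a x = -1 \<or> a x = 1"
    and b: "\<And>y. y \<in> Y \<Longrightarrow> b y = -1 \<or> b y = 1"
  shows "\<bar>\<Sum>(x, y)\<in>X \<times> Y. F (x, y) * pmf \<mu> (x, y) * (a x * b y)\<bar> \<le> 4 * disc_wrt \<mu> X Y F"
proof -
  let ?H = "\<lambda>x y. F (x, y) * pmf \<mu> (x, y)"
  define R where "R r s = (\<Sum>x\<in>{x\<in>X. a x = r}. \<Sum>y\<in>{y\<in>Y. b y = s}. ?H x y)" for r s
  have R: "\<bar>R r s\<bar> \<le> disc_wrt \<mu> X Y F" for r s
    using rectangle_le_disc_wrt[OF fin, of "{x\<in>X. a x = r}" "{y\<in>Y. b y = s}" F \<mu>]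
    by (simp add: R_def sum.cartesian_product)
  have "(\<Sum>(x, y)\<in>X \<times> Y. ?H x y * (a x * b y)) = (\<Sum>x\<in>X. (\<Sum>y\<in>Y. ?H x y * b y) * a x)"
    by (simp add: sum.cartesian_product[symmetric] sum_distrib_left mult_ac)
  also have "\<dots> = (R 1 1 - R 1 (-1)) - (R (-1) 1 - R (-1) (-1))"
    by (simp add: sum_sign_split[OF fin(1) a] sum_sign_split[OF fin(2) b] sum_subtractf R_def)
  finally show ?thesis using R[of 1 1] R[of 1 "-1"] R[of "-1" 1] R[of "-1" "-1"] by linarith
qed

lemma min_margin_le_4_disc_wrt:
  assumes c: "wt (2 * n) c \<le> 1" and \<mu>: "set_pmf \<mu> \<subseteq> cube n \<times> cube n"
  shows "min_margin (2 * n) (as_2n_vars n F) c \<le> 4 * disc_wrt \<mu> (cube n) (cube n) F"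
proof -
  let ?X = "cube n" and ?g = "as_2n_vars n F"
  let ?H = "\<lambda>x y. F (x, y) * pmf \<mu> (x, y)"
  let ?a = "\<lambda>S x. chi (S \<inter> {..<n}) x" and ?b = "\<lambda>S y. chi {i. n + i \<in> S} y"
  let ?Q = "\<lambda>S. \<Sum>(x, y)\<in>?X \<times> ?X. ?H x y * (?a S x * ?b S y)"
  have total: "(\<Sum>xy\<in>?X \<times> ?X. pmf \<mu> xy) = 1"
    using \<mu> by (intro sum_pmf_eq_1) auto
  \<comment> \<open>The minimum is at most the average under \<open>\<mu>\<close>. Expanded in
    characters, that average is an l1 combination of the correlations \<open>?Q S\<close>.\<close>
  have "min_margin (2 * n) ?g c = (\<Sum>xy\<in>?X \<times> ?X. min_margin (2 * n) ?g c * pmf \<mu> xy)"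
    by (simp add: total sum_distrib_left[symmetric])
  also have "\<dots> \<le> (\<Sum>(x, y)\<in>?X \<times> ?X. mlpoly (2 * n) c (cube_join n x y) * ?H x y)"
  proof (rule sum_mono, clarify)
    fix x y assume xy: "x \<in> ?X" "y \<in> ?X"
    have "min_margin (2 * n) ?g c \<le> mlpoly (2 * n) c (cube_join n x y) * F (x, y)"
      using min_margin_le[OF cube_join_in_cube[OF xy], of c ?g]
      by (simp add: as_2n_vars_cube_join xy)
    then show "min_margin (2 * n) ?g c * pmf \<mu> (x, y)
        \<le> mlpoly (2 * n) c (cube_join n x y) * ?H x y"
      by (simp add: mult.assoc[symmetric] mult_right_mono)
  qed
  also have "\<dots> = (\<Sum>(x, y)\<in>?X \<times> ?X. \<Sum>S\<in>Pow {..<2 * n}. c S * (?H x y * (?a S x * ?b S y)))"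
  proof (intro sum.cong refl, clarify)
    fix x y
    have "mlpoly (2 * n) c (cube_join n x y) = (\<Sum>S\<in>Pow {..<2 * n}. c S * (?a S x * ?b S y))"
      unfolding mlpoly_def by (intro sum.cong refl) (simp add: chi_cube_join)
    then show "mlpoly (2 * n) c (cube_join n x y) * ?H x y
        = (\<Sum>S\<in>Pow {..<2 * n}. c S * (?H x y * (?a S x * ?b S y)))"
      by (simp only: sum_distrib_right) (simp add: mult_ac)
  qed
  also have "\<dots> = (\<Sum>S\<in>Pow {..<2 * n}. c S * ?Q S)"
    unfolding sum_distrib_left case_prod_unfold by (rule sum.swap)
  also have "\<dots> \<le> \<bar>\<Sum>S\<in>Pow {..<2 * n}. c S * ?Q S\<bar>" by simp
  also have "\<dots> \<le> 4 * disc_wrt \<mu> ?X ?X F"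
  proof (rule l1_combination_bound)
    fix S assume "S \<in> Pow {..<2 * n}"
    then show "\<bar>?Q S\<bar> \<le> 4 * disc_wrt \<mu> ?X ?X F"
      by (intro sign_product_le_4_disc_wrt finite_cube chi_sign[of _ n]) auto
  qed (use c in \<open>auto simp: wt_def disc_wrt_nonneg\<close>)
  finally show ?thesis .
qed

text \<open>The preceding bound holds for every pair of \<open>c\<close> and \<open>\<mu>\<close>,
  so the supremum and the infimum can be taken separately.\<close>

lemma margin_le_4_disc:
  assumes F: "\<And>x y. x \<in> cube n \<Longrightarrow> y \<in> cube n \<Longrightarrow> F (x, y) \<in> {-1, 1}"
  shows "margin (2 * n) (as_2n_vars n F) \<le> 4 * disc (cube n) (cube n) F"
proof -
  have "margin (2 * n) (as_2n_vars n F) / 4 \<le> disc (cube n) (cube n) F"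
    unfolding disc_def
  proof (rule cINF_greatest)
    obtain x where "x \<in> cube n" using cube_nonempty by blast
    then have "return_pmf (x, x) \<in> {\<mu>. set_pmf \<mu> \<subseteq> cube n \<times> cube n}" by simp
    then show "{\<mu>. set_pmf \<mu> \<subseteq> cube n \<times> cube n} \<noteq> {}" by blast
    fix \<mu> assume \<mu>: "\<mu> \<in> {\<mu>. set_pmf \<mu> \<subseteq> cube n \<times> cube n}"
    have "margin (2 * n) (as_2n_vars n F) \<le> 4 * disc_wrt \<mu> (cube n) (cube n) F"
      unfolding margin_eq
    proof (rule cSUP_least)
      show "representing (2 * n) (as_2n_vars n F) \<noteq> {}"
        by (intro representing_nonempty as_2n_vars_in F)
    qed (use \<mu> in \<open>auto simp: representing_def intro!: min_margin_le_4_disc_wrt\<close>)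
    then show "margin (2 * n) (as_2n_vars n F) / 4 \<le> disc_wrt \<mu> (cube n) (cube n) F" by simp
  qed
  then show ?thesis by simp
qed

section \<open>Discrepancy of the lifted function against the margin\<close>

lemma pmf_of_finite_weights:
  fixes w :: "'a \<Rightarrow> real"
  assumes "finite A" "\<And>x. x \<in> A \<Longrightarrow> 0 \<le> w x" "(\<Sum>x\<in>A. w x) = 1"
  obtains p where "set_pmf p \<subseteq> A" "\<And>x. x \<in> A \<Longrightarrow> pmf p x = w x"
proof -
  define v where "v x = (if x \<in> A then w x else 0)" for x
  have "(\<integral>\<^sup>+ x. ennreal (v x) \<partial>count_space UNIV) = (\<Sum>x\<in>A. ennreal (v x))"
    using assms(1) by (intro nn_integral_count_space'[of A]) (auto simp: v_def)
  also have "\<dots> = ennreal (\<Sum>x\<in>A. w x)"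
    using assms(2) by (subst sum_ennreal[symmetric]) (auto simp: v_def intro!: sum.cong)
  finally have "(\<integral>\<^sup>+ x. ennreal (v x) \<partial>count_space UNIV) = 1" using assms(3) by simp
  moreover have "0 \<le> v x" for x using assms(2) by (simp add: v_def)
  ultimately have pmf: "pmf (embed_pmf v) x = v x" for x by (intro pmf_embed_pmf)
  show thesis
    by (rule that[of "embed_pmf v"]) (auto simp: set_pmf_iff pmf v_def split: if_splits)
qed

lemma disc_XOR_le_margin:
  assumes f: "f \<in> cube n \<rightarrow> {-1, 1}"
  shows "disc (cube n) (cube n) (comp_XOR n f) \<le> margin n f"
proof (rule field_le_epsilon)
  fix \<epsilon> :: real assume "\<epsilon> > 0"
  then obtain \<mu> where \<mu>: "\<And>x. x \<in> cube n \<Longrightarrow> 0 \<le> \<mu> x" "(\<Sum>x\<in>cube n. \<mu> x) = 1"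
    and coeff: "\<And>S. S \<in> Pow {..<n} \<Longrightarrow> \<bar>\<Sum>x\<in>cube n. \<mu> x * (f x * chi S x)\<bar> \<le> margin n f + \<epsilon>"
  \<comment> \<open>With payoff \<open>f x * chi S x\<close>, a strategy \<open>c\<close> earns
    \<open>mlpoly n c x * f x\<close> at \<open>x\<close>.\<close>
  proof (rule approx_minimax_l1[of "cube n" "Pow {..<n}" "\<lambda>S x. f x * chi S x" "margin n f", rotated 4])
    fix c :: "nat set \<Rightarrow> real" assume "(\<Sum>S\<in>Pow {..<n}. \<bar>c S\<bar>) \<le> 1"
    then have "\<exists>x\<in>cube n. mlpoly n c x * f x \<le> margin n f"
      by (intro margin_witness f) (simp add: wt_def)
    moreover have "mlpoly n c x * f x = (\<Sum>S\<in>Pow {..<n}. c S * (f x * chi S x))" for x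
      unfolding mlpoly_def sum_distrib_right by (simp add: mult_ac)
    ultimately show "\<exists>x\<in>cube n. (\<Sum>S\<in>Pow {..<n}. c S * (f x * chi S x)) \<le> margin n f"
      by simp
  next
    fix S x assume "S \<in> Pow {..<n}" "x \<in> cube n"
    then show "\<bar>f x * chi S x\<bar> \<le> 1" using f abs_chi[of x n S] by (auto simp: abs_mult Pi_iff)
  qed auto
  \<comment> \<open>The law of \<open>(x, cube_mult n x z)\<close> for uniform \<open>x\<close> and
    independent \<open>z\<close> drawn from \<open>\<mu>\<close>; translation invariance gives total
    mass 1.\<close>
  define w where "w = (\<lambda>(x, y). \<mu> (cube_mult n x y) / 2 ^ n)"
  have "(\<Sum>xy\<in>cube n \<times> cube n. w xy) = (\<Sum>x\<in>cube n. \<Sum>y\<in>cube n. \<mu> (cube_mult n x y) / 2 ^ n)"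
    by (simp add: w_def sum.cartesian_product)
  also have "\<dots> = (\<Sum>x\<in>cube n. 1 / 2 ^ n)"
    by (simp add: sum_divide_distrib[symmetric] sum_cube_mult \<mu>(2))
  also have "\<dots> = 1" by (simp add: card_cube)
  finally have total: "(\<Sum>xy\<in>cube n \<times> cube n. w xy) = 1" .
  have "0 \<le> w xy" if "xy \<in> cube n \<times> cube n" for xy
    using that \<mu>(1) cube_mult_in_cube by (auto simp: w_def)
  then obtain p where p: "set_pmf p \<subseteq> cube n \<times> cube n"
    and pmf_p: "\<And>xy. xy \<in> cube n \<times> cube n \<Longrightarrow> pmf p xy = w xy"
    using pmf_of_finite_weights[of "cube n \<times> cube n" w] total by auto
  have "disc (cube n) (cube n) (comp_XOR n f) \<le> disc_wrt p (cube n) (cube n) (comp_XOR n f)"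
    unfolding disc_def using p
    by (intro cINF_lower bdd_belowI2[of _ 0]) (auto simp: disc_wrt_nonneg)
  also have "\<dots> \<le> margin n f + \<epsilon>"
  proof (rule disc_wrt_le)
    fix A B assume AB: "A \<subseteq> cube n" "B \<subseteq> cube n"
    \<comment> \<open>By \<open>coeff\<close> the Fourier coefficients of \<open>g\<close> are at
      most \<open>margin n f + \<epsilon>\<close> in absolute value. The factor \<open>2 ^ n\<close>
      of the rectangle bound cancels the normalisation in \<open>w\<close>.\<close>
    define g where "g z = \<mu> z * f z" for z
    have "(\<Sum>(x, y)\<in>A \<times> B. comp_XOR n f (x, y) * pmf p (x, y))
        = (\<Sum>(x, y)\<in>A \<times> B. g (cube_mult n x y) / 2 ^ n)"
    proof (rule sum.cong[OF refl], clarify)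
      fix x y assume "x \<in> A" "y \<in> B"
      then have "(x, y) \<in> cube n \<times> cube n" using AB by auto
      then show "comp_XOR n f (x, y) * pmf p (x, y) = g (cube_mult n x y) / 2 ^ n"
        by (simp only: pmf_p) (simp add: w_def g_def comp_XOR_eq)
    qed
    also have "\<dots> = (\<Sum>x\<in>A. \<Sum>y\<in>B. g (cube_mult n x y)) / 2 ^ n"
      by (simp add: sum.cartesian_product[symmetric] sum_divide_distrib)
    finally have eq: "(\<Sum>(x, y)\<in>A \<times> B. comp_XOR n f (x, y) * pmf p (x, y))
        = (\<Sum>x\<in>A. \<Sum>y\<in>B. g (cube_mult n x y)) / 2 ^ n" .
    have "\<bar>\<Sum>x\<in>A. \<Sum>y\<in>B. g (cube_mult n x y)\<bar> \<le> 2 ^ n * (margin n f + \<epsilon>)"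
      using AB by (rule convolution_rectangle_bound) (use coeff in \<open>simp add: g_def mult.assoc\<close>)
    then show "\<bar>\<Sum>(x, y)\<in>A \<times> B. comp_XOR n f (x, y) * pmf p (x, y)\<bar> \<le> margin n f + \<epsilon>"
      unfolding eq by (simp add: abs_divide divide_le_eq mult.commute)
  qed auto
  finally show "disc (cube n) (cube n) (comp_XOR n f) \<le> margin n f + \<epsilon>" .
qed

theorem mainTheorem4:
  fixes n :: nat and f :: "(nat \<Rightarrow> real) \<Rightarrow> real"
  assumes "f \<in> cube n \<rightarrow> {-1, 1}"
  shows "margin n f \<le> margin (2 * n) (as_2n_vars n (comp_XOR n f))
       \<and> margin (2 * n) (as_2n_vars n (comp_XOR n f)) \<le> 4 * disc (cube n) (cube n) (comp_XOR n f)
       \<and> 4 * disc (cube n) (cube n) (comp_XOR n f) \<le> 4 * margin n f"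
  using margin_le_margin_XOR[OF assms] margin_le_4_disc[of n "comp_XOR n f", OF comp_XOR_in[OF assms]]
    disc_XOR_le_margin[OF assms] by simp

end
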